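(* There is a null set $\mathfrak N\subset\mathfrak S$ (a set of probability zero) such that for any $\omega\in\mathfrak S\cap\mathfrak N^c$ the following holds: the series $S_{1,\infty}(\omega)=\sum_{i=1}^{\infty}X_i(\omega)$ converges (written $S_{1,\infty}(\omega)<\infty$) if and only if there exists a non-negative sequence $\{c_j(\omega)\}_{j=1}^{\infty}$, monotonically decreasing to zero, such that for any choice of the sequence $\{n_j\}_{j=1}^{\infty}$ of positive integers, $$\pi\left(\mathcal N_1\mid y_{k,n_k}(\omega)\right)\rightarrow 1\quad\text{as } k\rightarrow\infty,$$ where $\mathcal N_1$ is any neighborhood of $1$.
   Context: $X_1,X_2,\ldots$ are real-valued random variables on a probability space with sample space $\mathfrak S$; no assumption (not even independence) is made on their joint distribution. For $\omega\in\mathfrak S$, $S_{1,\infty}(\omega)=\sum_{i=1}^\infty X_i(\omega)$, and $S_{1,\infty}(\omega)<\infty$ means that this series is convergent. For a sequence of positive integers $\{n_j\}_{j\ge1}$, with $n_0=0$, set for $j\ge 1$ $$S_{j,n_j}(\omega)=\sum_{i=\sum_{l=0}^{j-1}n_l+1}^{\sum_{l=0}^{j}n_l}X_i(\omega).$$ Given a non-negative decreasing sequence $\{c_j(\omega)\}_{j\ge 1}$, which is allowed to depend on $\omega$, let $y_{j,n_j}(\omega)=1$ if $|S_{j,n_j}(\omega)|\le c_j(\omega)$ and $y_{j,n_j}(\omega)=0$ otherwise. The probability $p_{k,n_k}=P(Y_{k,n_k}=1)$ is given a recursively constructed Beta prior; the resulting stage-$k$ posterior distribution of $p_{k,n_k}\in[0,1]$,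 denoted $\pi(\cdot\mid y_{k,n_k}(\omega))$, is the Beta distribution $$\mathrm{Beta}\left(\sum_{j=1}^k\frac1{j^2}+\sum_{j=1}^k y_{j,n_j}(\omega),\; k+\sum_{j=1}^k\frac1{j^2}-\sum_{j=1}^k y_{j,n_j}(\omega)\right),$$ where $\mathrm{Beta}(a,b)$ has mean $a/(a+b)$. For a set $A$, $\pi(A\mid y_{k,n_k}(\omega))$ is the probability that this distribution assigns to $A$. *)

theory Defs
  imports "HOL-Probability.Probability"
begin

definition beta_density :: "real \<Rightarrow> real \<Rightarrow> real \<Rightarrow> real" where
  "beta_density a b p =
     (if 0 < p \<and> p < 1 then p powr (a - 1) * (1 - p) powr (b - 1) / Beta a b else 0)"

definition beta_distribution :: "real \<Rightarrow> real \<Rightarrow> real measure" where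
  "beta_distribution a b = density lborel (\<lambda>p. ennreal (beta_density a b p))"

lemma beta_density_measurable [measurable]: "beta_density a b \<in> borel_measurable borel"
  unfolding beta_density_def by measurable

lemma sets_beta_distribution [simp]: "sets (beta_distribution a b) = sets borel"
  by (simp add: beta_distribution_def)

lemma Beta_real_pos:
  fixes a b :: real
  assumes "a > 0" "b > 0"
  shows "Beta a b > 0"
  using assms by (simp add: Beta_def Gamma_real_pos)

lemma beta_density_nonneg:
  assumes "a > 0" "b > 0"
  shows "beta_density a b p \<ge> 0"
  using Beta_real_pos[OF assms] by (simp add: beta_density_def)

lemma has_integral_beta_density:
  assumes "a > 0" "b > 0"
  shows "(beta_density a b has_integral 1) UNIV"
proof -
  have "((\<lambda>t. t powr (a - 1) * (1 - t) powr (b - 1) / Beta a b) has_integral 1) {0..1}"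
    using has_integral_divide[OF has_integral_Beta_real[OF assms], of "Beta a b"]
      Beta_real_pos[OF assms] by simp
  hence "(beta_density a b has_integral 1) {0..1}"
    by (rule has_integral_spike[where S = "{0, 1}", rotated 2]) (auto simp: beta_density_def)
  thus ?thesis
    by (rule has_integral_on_superset) (auto simp: beta_density_def)
qed

lemma prob_space_beta_distribution:
  assumes "a > 0" "b > 0"
  shows "prob_space (beta_distribution a b)"
proof
  have "(\<integral>\<^sup>+ p. ennreal (beta_density a b p) \<partial>lborel) = ennreal 1"
    using nn_integral_has_integral_lborel[OF beta_density_measurable
      beta_density_nonneg[OF assms] has_integral_beta_density[OF assms]] by simp
  thus "emeasure (beta_distribution a b) (space (beta_distribution a b)) = 1"
    by (simp add: beta_distribution_def emeasure_density)
qed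

lemma beta_distribution_mean:
  assumes "a > 0" "b > 0"
  shows "(LINT p|beta_distribution a b. p) = a / (a + b)"
proof -
  have B: "Beta a b > 0" "Beta (a + 1) b = a / (a + b) * Beta a b"
    using Beta_real_pos[OF assms] Beta_plus1_left[of a b] assms
    by (auto simp: field_simps nonpos_Ints_def)
  have eq: "beta_density a b p * p = a / (a + b) * beta_density (a + 1) b p" for p
  proof (cases "0 < p \<and> p < 1")
    case True
    have "p powr a = p powr (a - 1) * p"
      using True powr_add[of p "a - 1" 1] by simp
    thus ?thesis
      using True B assms by (simp add: beta_density_def)
  qed (auto simp: beta_density_def)
  have "integral\<^sup>L lborel (beta_density (a + 1) b) = 1"
    using prob_space.emeasure_space_1[OF prob_space_beta_distribution[of "a + 1" b]] assms
    by (intro integral_eq_nn_integral[THEN trans])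
       (auto simp: beta_density_nonneg beta_distribution_def emeasure_density)
  moreover have "(LINT p|beta_distribution a b. p) = (LINT p|lborel. beta_density a b p * p)"
    unfolding beta_distribution_def
    using beta_density_nonneg[OF assms] by (subst integral_density) auto
  ultimately show ?thesis
    by (simp add: eq)
qed

text \<open>All sequences below are indexed from 1; a block-length sequence has \<open>n 0 = 0\<close>.\<close>

definition block_sum :: "(nat \<Rightarrow> real) \<Rightarrow> (nat \<Rightarrow> nat) \<Rightarrow> nat \<Rightarrow> real" where
  "block_sum x n j = (\<Sum>i = (\<Sum>l = 0..j - 1. n l) + 1..(\<Sum>l = 0..j. n l). x i)"

definition block_indicator ::
    "(nat \<Rightarrow> real) \<Rightarrow> (nat \<Rightarrow> real) \<Rightarrow> (nat \<Rightarrow> nat) \<Rightarrow> nat \<Rightarrow> real" where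
  "block_indicator x c n j = (if \<bar>block_sum x n j\<bar> \<le> c j then 1 else 0)"

text \<open>For \<open>k \<ge> 1\<close> both parameters are positive.\<close>

definition posterior ::
    "(nat \<Rightarrow> real) \<Rightarrow> (nat \<Rightarrow> real) \<Rightarrow> (nat \<Rightarrow> nat) \<Rightarrow> nat \<Rightarrow> real measure" where
  "posterior x c n k =
     beta_distribution
       ((\<Sum>j = 1..k. 1 / real j ^ 2) + (\<Sum>j = 1..k. block_indicator x c n j))
       (real k + (\<Sum>j = 1..k. 1 / real j ^ 2) - (\<Sum>j = 1..k. block_indicator x c n j))"

text \<open>
  Neighborhoods of 1 in the parameter space \<open>[0, 1]\<close>, restricted to Borel sets so that their
  probability is defined. Points outside \<open>[0, 1]\<close> are permitted, so neighborhoods of 1 in the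
  real line are covered too; they carry no mass.
\<close>

definition nbhd_of_one :: "real set \<Rightarrow> bool" where
  "nbhd_of_one A \<longleftrightarrow> A \<in> sets borel \<and> (\<exists>U. open U \<and> 1 \<in> U \<and> U \<inter> {0..1} \<subseteq> A)"

end

theory Submission
  imports Defs
begin

text \<open>
  The equivalence holds at every sample point, so the empty set serves as the null set, and what
  has to be proved is a statement about one real sequence \<open>x\<close> with partial sums \<open>P\<close>. A block sum
  is an increment of \<open>P\<close> between two cut points. The Beta parameters are such that the
  posterior mean is asymptotic to the proportion of blocks that are small in the sense of \<open>c\<close>
  (lemma \<open>posterior_mean_tendsto\<close>), because the prior contributes only the bounded quantity
  \<open>\<Sum>1/j\<^sup>2\<close>. By Markov's inequality, a mean tending to 1 or to 0 forces the posterior mass onto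
  that end of the unit interval.

  If the series converges, let \<open>c j\<close> be twice the largest distance from the limit that \<open>P\<close> attains
  from index \<open>j - 1\<close> onwards. As blocks are nonempty, block \<open>j\<close> lies beyond index \<open>j - 1\<close>, so all blocks
  are small for every choice of block lengths, and the posterior concentrates at 1.

  If the series diverges, the Cauchy criterion fails for some \<open>\<epsilon>\<close>, so from every index \<open>t\<close> there is
  a later one at which \<open>P\<close> differs from \<open>P t\<close> by at least \<open>\<epsilon> / 2\<close>: otherwise all later values would
  lie within \<open>\<epsilon> / 2\<close> of \<open>P t\<close>. Cutting greedily at such indices makes every block sum at
  least \<open>\<epsilon> / 2\<close> in absolute value. Whatever \<open>c\<close> tending to 0 is given, only finitely many
  of these blocks are small, so the posterior concentrates at 0 instead of 1.
\<close>

section \<open>Concentration of Beta distributions\<close>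

lemma AE_beta_distribution_unit_interval:
  "AE p in beta_distribution a b. 0 \<le> p \<and> p \<le> 1"
  unfolding beta_distribution_def
  by (subst AE_density) (auto simp: beta_density_def intro!: AE_I2)

lemma integrable_beta_distribution_id:
  assumes "a > 0" "b > 0"
  shows "integrable (beta_distribution a b) (\<lambda>p. p)"
proof -
  interpret prob_space "beta_distribution a b"
    by (rule prob_space_beta_distribution[OF assms])
  have "AE p in beta_distribution a b. norm p \<le> 1"
    using AE_beta_distribution_unit_interval by eventually_elim auto
  thus ?thesis
    by (intro integrable_const_bound) (auto simp: measurable_def)
qed

lemma beta_distribution_upper_Markov:
  assumes "a > 0" "b > 0" "e > 0"
  shows "measure (beta_distribution a b) {e..} \<le> a / (a + b) / e"
proof -
  interpret prob_space "beta_distribution a b"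
    by (rule prob_space_beta_distribution[OF assms(1,2)])
  have sp: "space (beta_distribution a b) = UNIV"
    by (simp add: beta_distribution_def)
  have "measure (beta_distribution a b) {p \<in> space (beta_distribution a b). e \<le> p}
      \<le> (LINT p|beta_distribution a b. p) / e"
    using integrable_beta_distribution_id[OF assms(1,2)] AE_beta_distribution_unit_interval assms(3)
    by (intro integral_Markov_inequality_measure[where A = "{}"]) auto
  thus ?thesis
    by (simp add: beta_distribution_mean[OF assms(1,2)] sp atLeast_def)
qed

lemma beta_distribution_lower_Markov:
  assumes "a > 0" "b > 0" "e > 0"
  shows "measure (beta_distribution a b) {..1 - e} \<le> (1 - a / (a + b)) / e"
proof -
  interpret prob_space "beta_distribution a b"
    by (rule prob_space_beta_distribution[OF assms(1,2)])
  have sp: "space (beta_distribution a b) = UNIV"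
    by (simp add: beta_distribution_def)
  have int: "integrable (beta_distribution a b) (\<lambda>p. p)"
    by (rule integrable_beta_distribution_id[OF assms(1,2)])
  have "measure (beta_distribution a b) {p \<in> space (beta_distribution a b). e \<le> 1 - p}
      \<le> (LINT p|beta_distribution a b. 1 - p) / e"
    using int AE_beta_distribution_unit_interval assms(3)
    by (intro integral_Markov_inequality_measure[where A = "{}"]) auto
  also have "(LINT p|beta_distribution a b. 1 - p) = 1 - a / (a + b)"
    using int by (simp add: beta_distribution_mean[OF assms(1,2)] prob_space)
  also have "{p \<in> space (beta_distribution a b). e \<le> 1 - p} = {..1 - e}"
    by (auto simp: sp)
  finally show ?thesis .
qed

text \<open>
  A neighborhood of 1 contains the part of the unit interval within some distance \<open>e\<close> of 1, so
  Markov's inequality for \<open>1 - p\<close> bounds its mass from below through the mean alone. Since \<open>e\<close>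
  does not depend on the parameters, the bound applies along a whole sequence of Beta distributions.
\<close>

lemma beta_distribution_nbhd_of_one_bound:
  assumes "nbhd_of_one A"
  obtains e where "e > 0"
    "\<And>a b. a > 0 \<Longrightarrow> b > 0 \<Longrightarrow> 1 - (1 - a / (a + b)) / e \<le> measure (beta_distribution a b) A"
proof -
  from assms obtain U where A: "A \<in> sets borel" and U: "open U" "1 \<in> U" "U \<inter> {0..1} \<subseteq> A"
    by (auto simp: nbhd_of_one_def)
  then obtain e where e: "e > 0" "ball 1 e \<subseteq> U"
    by (meson open_contains_ball)
  have "1 - (1 - a / (a + b)) / e \<le> measure (beta_distribution a b) A" if ab: "a > 0" "b > 0" for a b
  proof -
    interpret prob_space "beta_distribution a b"
      by (rule prob_space_beta_distribution[OF ab])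
    have sp: "space (beta_distribution a b) = UNIV"
      by (simp add: beta_distribution_def)
    have "AE p in beta_distribution a b. p \<in> - {..1 - e} \<longrightarrow> p \<in> A"
      using AE_beta_distribution_unit_interval
    proof eventually_elim
      case (elim p)
      show ?case
      proof
        assume "p \<in> - {..1 - e}"
        with elim have "p \<in> ball 1 e" by (auto simp: dist_real_def)
        with e(2) U(3) elim show "p \<in> A" by (auto simp del: mem_ball)
      qed
    qed
    hence "prob (- {..1 - e}) \<le> prob A"
      using A by (intro finite_measure_mono_AE) auto
    moreover have "prob (- {..1 - e}) = 1 - prob {..1 - e}"
      using prob_compl[of "{..1 - e}"] by (simp add: sp Compl_eq_Diff_UNIV)
    ultimately show ?thesis
      using beta_distribution_lower_Markov[OF ab e(1)] by linarith
  qed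
  with e(1) that show ?thesis by blast
qed

section \<open>Asymptotics of the posterior\<close>

abbreviation prior_weight :: "nat \<Rightarrow> real" where
  "prior_weight k \<equiv> \<Sum>j = 1..k. 1 / real j ^ 2"

abbreviation small_block_count ::
    "(nat \<Rightarrow> real) \<Rightarrow> (nat \<Rightarrow> real) \<Rightarrow> (nat \<Rightarrow> nat) \<Rightarrow> nat \<Rightarrow> real" where
  "small_block_count x c n k \<equiv> \<Sum>j = 1..k. block_indicator x c n j"

abbreviation posterior_mean ::
    "(nat \<Rightarrow> real) \<Rightarrow> (nat \<Rightarrow> real) \<Rightarrow> (nat \<Rightarrow> nat) \<Rightarrow> nat \<Rightarrow> real" where
  "posterior_mean x c n k \<equiv>
     (prior_weight k + small_block_count x c n k) /
     ((prior_weight k + small_block_count x c n k) +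
      (real k + prior_weight k - small_block_count x c n k))"

lemma small_block_count_bounds:
  "0 \<le> small_block_count x c n k" "small_block_count x c n k \<le> real k"
proof -
  show "0 \<le> small_block_count x c n k"
    by (intro sum_nonneg) (simp add: block_indicator_def)
  have "small_block_count x c n k \<le> (\<Sum>j = 1..k. 1)"
    by (intro sum_mono) (simp add: block_indicator_def)
  thus "small_block_count x c n k \<le> real k" by simp
qed

lemma posterior_parameters_pos:
  assumes "k \<ge> 1"
  shows "prior_weight k + small_block_count x c n k > 0"
    "real k + prior_weight k - small_block_count x c n k > 0"
proof -
  have "prior_weight k > 0"
    using assms by (intro sum_pos) auto
  with small_block_count_bounds[where x = x and c = c and n = n and k = k]
  show "prior_weight k + small_block_count x c n k > 0"
    "real k + prior_weight k - small_block_count x c n k > 0" by linarith+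
qed

lemma prior_weight_over_n_tendsto_0: "(\<lambda>k. prior_weight k / real k) \<longlonglongrightarrow> 0"
proof -
  have "(\<lambda>k. \<Sum>j<k. 1 / real (Suc j) ^ 2) \<longlonglongrightarrow> pi\<^sup>2 / 6"
    using inverse_squares_sums by (simp add: sums_def add.commute)
  hence "prior_weight \<longlonglongrightarrow> pi\<^sup>2 / 6"
    by (simp add: sum.atLeast1_atMost_eq)
  from tendsto_mult[OF this lim_1_over_n] show ?thesis
    by simp
qed

text \<open>
  The mean is \<open>(s + Y) / (k + 2 * s)\<close>, where \<open>Y\<close> counts the small blocks among the first \<open>k\<close> and
  the prior weight \<open>s\<close> stays bounded, so it is the proportion \<open>Y / k\<close> up to a vanishing error.
\<close>

lemma posterior_mean_tendsto:
  assumes "(\<lambda>k. small_block_count x c n k / real k) \<longlonglongrightarrow> q"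
  shows "(\<lambda>k. posterior_mean x c n k) \<longlonglongrightarrow> q"
proof -
  have "(\<lambda>k. (prior_weight k / real k + small_block_count x c n k / real k) /
      (1 + 2 * (prior_weight k / real k))) \<longlonglongrightarrow> (0 + q) / (1 + 2 * 0)"
    by (intro tendsto_intros assms prior_weight_over_n_tendsto_0) auto
  hence "(\<lambda>k. (prior_weight k / real k + small_block_count x c n k / real k) /
      (1 + 2 * (prior_weight k / real k))) \<longlonglongrightarrow> q" by simp
  moreover have "\<forall>\<^sub>F k in sequentially.
      (prior_weight k / real k + small_block_count x c n k / real k) /
        (1 + 2 * (prior_weight k / real k)) =
      posterior_mean x c n k"
    using eventually_ge_at_top[of 1]
  proof eventually_elim
    case (elim k)
    have "(s / real k + y / real k) / (1 + 2 * (s / real k)) = (s + y) / ((s + y) + (real k + s - y))"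
      for s y :: real
    proof -
      have "(s / real k + y / real k) = (s + y) / real k"
        "1 + 2 * (s / real k) = ((s + y) + (real k + s - y)) / real k"
        using elim by (simp_all add: field_simps)
      thus ?thesis using elim by simp
    qed
    thus ?case .
  qed
  ultimately show ?thesis
    by (rule Lim_transform_eventually)
qed

lemma posterior_concentrates_at_one:
  assumes "(\<lambda>k. small_block_count x c n k / real k) \<longlonglongrightarrow> 1" and "nbhd_of_one A"
  shows "(\<lambda>k. measure (posterior x c n k) A) \<longlonglongrightarrow> 1"
proof -
  obtain e where e: "e > 0"
    "\<And>a b. a > 0 \<Longrightarrow> b > 0 \<Longrightarrow> 1 - (1 - a / (a + b)) / e \<le> measure (beta_distribution a b) A"
    using beta_distribution_nbhd_of_one_bound[OF assms(2)] by blast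
  have "(\<lambda>k. 1 - (1 - posterior_mean x c n k) / e) \<longlonglongrightarrow> 1 - (1 - 1) / e"
    using e(1) by (intro tendsto_intros posterior_mean_tendsto assms) auto
  hence lower_lim: "(\<lambda>k. 1 - (1 - posterior_mean x c n k) / e) \<longlonglongrightarrow> 1"
    by simp
  have lower: "\<forall>\<^sub>F k in sequentially.
      1 - (1 - posterior_mean x c n k) / e \<le> measure (posterior x c n k) A"
    using eventually_ge_at_top[of 1]
    by eventually_elim (unfold posterior_def, intro e(2) posterior_parameters_pos)
  have upper: "\<forall>\<^sub>F k in sequentially. measure (posterior x c n k) A \<le> 1"
    using eventually_ge_at_top[of 1]
    by eventually_elim
      (unfold posterior_def,
       intro prob_space.prob_le_1 prob_space_beta_distribution posterior_parameters_pos)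
  show ?thesis
    by (rule tendsto_sandwich[OF lower upper lower_lim tendsto_const])
qed

lemma posterior_concentrates_at_zero:
  assumes "(\<lambda>k. small_block_count x c n k / real k) \<longlonglongrightarrow> 0" and "e > 0"
  shows "(\<lambda>k. measure (posterior x c n k) {e..}) \<longlonglongrightarrow> 0"
proof -
  have "(\<lambda>k. posterior_mean x c n k / e) \<longlonglongrightarrow> 0 / e"
    using assms(2) by (intro tendsto_intros posterior_mean_tendsto assms(1)) auto
  hence upper_lim: "(\<lambda>k. posterior_mean x c n k / e) \<longlonglongrightarrow> 0"
    by simp
  have upper: "\<forall>\<^sub>F k in sequentially.
      measure (posterior x c n k) {e..} \<le> posterior_mean x c n k / e"
    using eventually_ge_at_top[of 1]
    by eventually_elim
      (unfold posterior_def, intro beta_distribution_upper_Markov posterior_parameters_pos assms(2))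
  have lower: "\<forall>\<^sub>F k in sequentially. 0 \<le> measure (posterior x c n k) {e..}"
    by simp
  show ?thesis
    by (rule tendsto_sandwich[OF lower upper tendsto_const upper_lim])
qed

section \<open>Blocks of convergent and divergent series\<close>

lemma block_sum_eq_partial_sum_diff:
  assumes "j \<ge> 1"
  shows "block_sum x n j = (\<Sum>i = 1..(\<Sum>l = 0..j. n l). x i) - (\<Sum>i = 1..(\<Sum>l = 0..j - 1. n l). x i)"
proof -
  have "(\<Sum>l = 0..j - 1. n l) \<le> (\<Sum>l = 0..j. n l)"
    by (intro sum_mono2) auto
  hence "(\<Sum>i = 1..(\<Sum>l = 0..j. n l). x i) =
      (\<Sum>i = 1..(\<Sum>l = 0..j - 1. n l). x i) + block_sum x n j"
    unfolding block_sum_def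
    using sum.ub_add_nat[of 1 "\<Sum>l = 0..j - 1. n l" x "(\<Sum>l = 0..j. n l) - (\<Sum>l = 0..j - 1. n l)"]
    by simp
  thus ?thesis by simp
qed

lemma summable_iff_convergent_partial_sums:
  fixes x :: "nat \<Rightarrow> real"
  shows "summable (\<lambda>i. x (Suc i)) \<longleftrightarrow> convergent (\<lambda>t. \<Sum>i = 1..t. x i)"
  by (simp add: summable_iff_convergent sum.atLeast1_atMost_eq)

text \<open>The suprema of the tails are such a majorant.\<close>

lemma antimono_majorant_of_null_sequence:
  fixes d :: "nat \<Rightarrow> real"
  assumes "d \<longlonglongrightarrow> 0"
  obtains c where "antimono c" "c \<longlonglongrightarrow> 0" "\<And>s t. t \<le> s \<Longrightarrow> \<bar>d s\<bar> \<le> c t"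
proof
  let ?c = "\<lambda>t. SUP s\<in>{t..}. \<bar>d s\<bar>"
  obtain K where K: "\<And>s. \<bar>d s\<bar> \<le> K"
    using convergent_imp_Bseq[OF convergentI[OF assms]] by (auto simp: Bseq_def)
  have bdd: "bdd_above ((\<lambda>s. \<bar>d s\<bar>) ` S)" for S
    using K by (auto intro!: bdd_aboveI[where M = K])
  show upper: "\<bar>d s\<bar> \<le> ?c t" if "t \<le> s" for s t
    using that by (intro cSUP_upper bdd) auto
  show "antimono ?c"
    by (intro antimonoI cSUP_subset_mono bdd) auto
  show "?c \<longlonglongrightarrow> 0"
  proof (rule LIMSEQ_I)
    fix r :: real assume "r > 0"
    then obtain N where N: "\<And>s. s \<ge> N \<Longrightarrow> \<bar>d s\<bar> < r / 2"
      using LIMSEQ_D[OF assms, of "r / 2"] by auto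
    have "norm (?c t - 0) < r" if "t \<ge> N" for t
    proof -
      have "?c t \<le> r / 2"
        using that by (intro cSUP_least less_imp_le[OF N]) auto
      moreover have "0 \<le> ?c t"
        using upper[of t t] by simp
      ultimately show ?thesis using \<open>r > 0\<close> by simp
    qed
    thus "\<exists>N. \<forall>t\<ge>N. norm (?c t - 0) < r" by blast
  qed
qed

text \<open>
  Two cut points at or beyond index \<open>j - 1\<close> have partial sums within \<open>2 * b (j - 1)\<close> of each
  other, where \<open>b\<close> is a decreasing bound for the distance of the partial sums to their limit.
  Nonempty blocks guarantee that the cut points of block \<open>j\<close> lie there.
\<close>

lemma convergent_series_uniform_block_bound:
  fixes x :: "nat \<Rightarrow> real"
  assumes "summable (\<lambda>i. x (Suc i))"
  obtains c :: "nat \<Rightarrow> real" where "\<And>j. 0 \<le> c j" "antimono c" "c \<longlonglongrightarrow> 0"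
    "\<And>n j. \<forall>j\<ge>1. 0 < n j \<Longrightarrow> j \<ge> 1 \<Longrightarrow> \<bar>block_sum x n j\<bar> \<le> c j"
proof -
  define P where "P = (\<lambda>t. \<Sum>i = 1..t. x i)"
  from assms obtain L where "P \<longlonglongrightarrow> L"
    unfolding summable_iff_convergent_partial_sums P_def by (auto simp: convergent_def)
  hence "(\<lambda>t. P t - L) \<longlonglongrightarrow> 0"
    by (simp add: LIM_zero_iff)
  then obtain b where b: "antimono b" "b \<longlonglongrightarrow> 0" "\<And>s t. t \<le> s \<Longrightarrow> \<bar>P s - L\<bar> \<le> b t"
    by (rule antimono_majorant_of_null_sequence) blast
  show thesis
  proof
    show "0 \<le> 2 * b (j - 1)" for j
      using b(3)[of "j - 1" "j - 1"] by simp
    show "antimono (\<lambda>j. 2 * b (j - 1))"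
      using b(1) by (auto simp: antimono_def intro: diff_le_mono)
    have "(\<lambda>j. b (j - 1)) \<longlonglongrightarrow> 0"
      using b(2) by (subst filterlim_sequentially_Suc[symmetric]) simp
    from tendsto_mult_left[OF this, of 2] show "(\<lambda>j. 2 * b (j - 1)) \<longlonglongrightarrow> 0" by simp
    fix n :: "nat \<Rightarrow> nat" and j :: nat
    assume n: "\<forall>j\<ge>1. 0 < n j" and j: "j \<ge> 1"
    \<comment> \<open>Each of the blocks up to \<open>m\<close> contributes at least 1 to the cut point.\<close>
    have cut: "m \<le> (\<Sum>l = 0..m. n l)" for m
    proof (induction m)
      case (Suc m)
      moreover have "0 < n (Suc m)" using n by simp
      ultimately show ?case by simp
    qed simp
    have "j - 1 \<le> (\<Sum>l = 0..j. n l)"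
      using cut[of j] by simp
    from b(3)[OF this] b(3)[OF cut[of "j - 1"]]
    show "\<bar>block_sum x n j\<bar> \<le> 2 * b (j - 1)"
      unfolding block_sum_eq_partial_sum_diff[OF j] P_def by linarith
  qed
qed

text \<open>
  The Cauchy criterion yields two late indices with distant values; fixing one of them to be \<open>t\<close>
  itself, as the greedy construction of blocks requires, costs a factor of 2.
\<close>

lemma nonconvergent_large_later_increment:
  fixes P :: "nat \<Rightarrow> real"
  assumes "\<not> convergent P"
  obtains d where "d > 0" "\<And>t. \<exists>m>t. d \<le> \<bar>P m - P t\<bar>"
proof -
  from assms have "\<not> Cauchy P"
    by (simp add: Cauchy_convergent_iff)
  then obtain e where e: "e > 0" "\<And>t. \<exists>m\<ge>t. \<exists>m'\<ge>t. e \<le> \<bar>P m - P m'\<bar>"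
    by (force simp: Cauchy_def dist_real_def not_less)
  have "\<exists>m>t. e / 2 \<le> \<bar>P m - P t\<bar>" for t
  proof (rule ccontr)
    assume "\<not> ?thesis"
    hence *: "\<bar>P m - P t\<bar> < e / 2" if "m \<ge> t" for m
      using e(1) that by (cases "m = t") (auto simp: not_le)
    from e(2)[of t] obtain m m' where "m \<ge> t" "m' \<ge> t" "e \<le> \<bar>P m - P m'\<bar>" by blast
    with *[of m] *[of m'] show False by linarith
  qed
  with e(1) show thesis by (intro that[of "e / 2"]) auto
qed

text \<open>
  The cut points are the iterates of a function that sends each index to a later one where the
  partial sum has moved by at least \<open>d\<close>; the block lengths are the gaps between them.
\<close>

lemma divergent_series_large_blocks:
  fixes x :: "nat \<Rightarrow> real"
  assumes "\<not> summable (\<lambda>i. x (Suc i))"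
  obtains n :: "nat \<Rightarrow> nat" and d :: real where "n 0 = 0" "\<forall>j\<ge>1. 0 < n j" "d > 0"
    "\<And>j. j \<ge> 1 \<Longrightarrow> d \<le> \<bar>block_sum x n j\<bar>"
proof -
  define P where "P = (\<lambda>t. \<Sum>i = 1..t. x i)"
  from assms have "\<not> convergent P"
    by (simp add: summable_iff_convergent_partial_sums P_def)
  then obtain d where d: "d > 0" "\<And>t. \<exists>m>t. d \<le> \<bar>P m - P t\<bar>"
    by (rule nonconvergent_large_later_increment) blast
  then obtain f where f: "\<And>t. t < f t" "\<And>t. d \<le> \<bar>P (f t) - P t\<bar>" by metis
  define T where "T = (\<lambda>j. (f ^^ j) 0)"
  define n where "n = (\<lambda>j. T j - T (j - 1))"
  have T_Suc: "T (Suc j) = f (T j)" for j by (simp add: T_def)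
  have cuts: "(\<Sum>l = 0..j. n l) = T j" for j
  proof (induction j)
    case 0
    show ?case by (simp add: n_def T_def)
  next
    case (Suc j)
    thus ?case using f(1)[of "T j"] by (simp add: n_def T_Suc)
  qed
  show thesis
  proof
    show "n 0 = 0" by (simp add: n_def)
    show "\<forall>j\<ge>1. 0 < n j"
    proof (intro allI impI)
      fix j :: nat assume "j \<ge> 1"
      then obtain i where "j = Suc i" by (cases j) auto
      thus "0 < n j" using f(1)[of "T i"] by (simp add: n_def T_Suc)
    qed
    show "d > 0" by (rule d(1))
    fix j :: nat assume j: "j \<ge> 1"
    then obtain i where i: "j = Suc i" by (cases j) auto
    have "block_sum x n j = P (f (T i)) - P (T i)"
      unfolding block_sum_eq_partial_sum_diff[OF j] cuts by (simp add: i T_Suc P_def)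
    with f(2)[of "T i"] show "d \<le> \<bar>block_sum x n j\<bar>" by simp
  qed
qed

section \<open>The equivalence for a single sequence\<close>

lemma all_blocks_small_proportion_tendsto_1:
  assumes "\<And>j. j \<ge> 1 \<Longrightarrow> \<bar>block_sum x n j\<bar> \<le> c j"
  shows "(\<lambda>k. small_block_count x c n k / real k) \<longlonglongrightarrow> 1"
proof (rule tendsto_eventually)
  have "small_block_count x c n k = real k" for k
    using assms by (simp add: block_indicator_def)
  thus "\<forall>\<^sub>F k in sequentially. small_block_count x c n k / real k = 1"
    using eventually_ge_at_top[of 1] by (auto elim!: eventually_mono)
qed

text \<open>
  Once \<open>c j < d\<close>, a block of size at least \<open>d\<close> is never small, so the count of small blocks
  stays bounded.
\<close>

lemma large_blocks_small_proportion_tendsto_0: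
  assumes "c \<longlonglongrightarrow> 0" "d > 0" "\<And>j. j \<ge> 1 \<Longrightarrow> d \<le> \<bar>block_sum x n j\<bar>"
  shows "(\<lambda>k. small_block_count x c n k / real k) \<longlonglongrightarrow> 0"
proof -
  obtain J where J: "\<And>j. j \<ge> J \<Longrightarrow> c j < d"
    using order_tendstoD(2)[OF assms(1,2)] by (auto simp: eventually_sequentially)
  have zero: "block_indicator x c n j = 0" if "j \<ge> 1" "j \<ge> J" for j
    using assms(3)[OF that(1)] J[OF that(2)] by (simp add: block_indicator_def)
  have "small_block_count x c n k \<le> real J" for k
  proof -
    have "small_block_count x c n k = (\<Sum>j \<in> {1..k} \<inter> {..<J}. block_indicator x c n j)"
      by (rule sum.mono_neutral_right) (auto intro!: zero)
    also have "\<dots> \<le> (\<Sum>j \<in> {1..k} \<inter> {..<J}. 1)"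
      by (intro sum_mono) (simp add: block_indicator_def)
    also have "\<dots> \<le> real J"
      using card_mono[of "{..<J}" "{1..k} \<inter> {..<J}"] by simp
    finally show ?thesis .
  qed
  hence upper: "small_block_count x c n k / real k \<le> real J / real k" for k
    by (intro divide_right_mono) auto
  have lower: "0 \<le> small_block_count x c n k / real k" for k
    by (intro divide_nonneg_nonneg small_block_count_bounds(1)) simp
  show ?thesis
  proof (rule tendsto_sandwich[OF _ _ tendsto_const lim_const_over_n[of "real J"]])
    show "\<forall>\<^sub>F k in sequentially. 0 \<le> small_block_count x c n k / real k"
      by (rule always_eventually[OF allI[OF lower]])
    show "\<forall>\<^sub>F k in sequentially. small_block_count x c n k / real k \<le> real J / real k"
      by (rule always_eventually[OF allI[OF upper]])
  qed
qed

lemma summable_iff_posteriors_concentrate_at_one: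
  fixes x :: "nat \<Rightarrow> real"
  shows "summable (\<lambda>i. x (Suc i)) \<longleftrightarrow>
    (\<exists>c :: nat \<Rightarrow> real. (\<forall>j\<ge>1. 0 \<le> c j) \<and> antimono_on {1..} c \<and> c \<longlonglongrightarrow> 0 \<and>
      (\<forall>n :: nat \<Rightarrow> nat. n 0 = 0 \<and> (\<forall>j\<ge>1. 0 < n j) \<longrightarrow>
        (\<forall>A. nbhd_of_one A \<longrightarrow> (\<lambda>k. measure (posterior x c n k) A) \<longlonglongrightarrow> 1)))"
    (is "_ \<longleftrightarrow> (\<exists>c. ?good c)")
proof
  assume "summable (\<lambda>i. x (Suc i))"
  then obtain c :: "nat \<Rightarrow> real" where c: "\<And>j. 0 \<le> c j" "antimono c" "c \<longlonglongrightarrow> 0"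
    "\<And>n j. \<forall>j\<ge>1. 0 < n j \<Longrightarrow> j \<ge> 1 \<Longrightarrow> \<bar>block_sum x n j\<bar> \<le> c j"
    by (rule convergent_series_uniform_block_bound) blast
  have "?good c"
  proof (intro conjI allI impI)
    show "0 \<le> c j" for j by (rule c(1))
    show "antimono_on {1..} c"
      using c(2) by (rule monotone_on_subset) simp
    show "c \<longlonglongrightarrow> 0" by (rule c(3))
    fix n :: "nat \<Rightarrow> nat" and A
    assume "n 0 = 0 \<and> (\<forall>j\<ge>1. 0 < n j)" "nbhd_of_one A"
    thus "(\<lambda>k. measure (posterior x c n k) A) \<longlonglongrightarrow> 1"
      by (intro posterior_concentrates_at_one all_blocks_small_proportion_tendsto_1 c(4)) auto
  qed
  thus "\<exists>c. ?good c" by (rule exI[of ?good c])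
next
  assume "\<exists>c. ?good c"
  then obtain c where c: "?good c" ..
  show "summable (\<lambda>i. x (Suc i))"
  proof (rule ccontr)
    assume "\<not> summable (\<lambda>i. x (Suc i))"
    then obtain n d where n: "n 0 = 0" "\<forall>j\<ge>1. 0 < n j" "d > 0"
      "\<And>j. j \<ge> 1 \<Longrightarrow> d \<le> \<bar>block_sum x n j\<bar>"
      by (rule divergent_series_large_blocks) blast
    \<comment> \<open>Any closed half-line from a point strictly between 0 and 1 separates the two limits.\<close>
    have "nbhd_of_one {1 / 2..}"
      unfolding nbhd_of_one_def by (intro conjI exI[of _ "{1 / 2<..}"]) auto
    with c n(1,2) have "(\<lambda>k. measure (posterior x c n k) {1 / 2..}) \<longlonglongrightarrow> 1" by blast
    moreover have "(\<lambda>k. measure (posterior x c n k) {1 / 2..}) \<longlonglongrightarrow> 0"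
      using c n(3,4)
      by (intro posterior_concentrates_at_zero large_blocks_small_proportion_tendsto_0) auto
    ultimately show False
      using LIMSEQ_unique by fastforce
  qed
qed

theorem theorem5:
  fixes M :: "'a measure" and X :: "nat \<Rightarrow> 'a \<Rightarrow> real"
  assumes "prob_space M"
    and "\<And>i. i \<ge> 1 \<Longrightarrow> X i \<in> borel_measurable M"
  shows "\<exists>N \<in> null_sets M. \<forall>\<omega> \<in> space M - N.
    summable (\<lambda>i. X (Suc i) \<omega>) \<longleftrightarrow>
    (\<exists>c :: nat \<Rightarrow> real. (\<forall>j\<ge>1. 0 \<le> c j) \<and> antimono_on {1..} c \<and> c \<longlonglongrightarrow> 0 \<and>
      (\<forall>n :: nat \<Rightarrow> nat. n 0 = 0 \<and> (\<forall>j\<ge>1. 0 < n j) \<longrightarrow>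
        (\<forall>A. nbhd_of_one A \<longrightarrow>
          (\<lambda>k. measure (posterior (\<lambda>i. X i \<omega>) c n k) A) \<longlonglongrightarrow> 1)))"
proof (intro bexI[of _ "{}"] ballI)
  show "{} \<in> null_sets M" by simp
qed (rule summable_iff_posteriors_concentrate_at_one)

end
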